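(* For all $n\in\mathbb{N}$, $$\mu(n)=\min\left\{\mu\left(n-\binom{i}{2}\right)+i \;:\; i\in\mathbb{N},\ \binom{i}{2}\leq n\right\}.$$
   Context: $\mathbb{N}=\{1,2,3,\ldots\}$ and $\mathbb{N}_0=\{0,1,2,\ldots\}$. Let $T\subseteq\mathbb{N}_0^2$ be the additive monoid consisting of all finite linear combinations with coefficients in $\mathbb{N}_0$ of the vectors $z_i=\left(i,\binom{i}{2}\right)$, $i\in\mathbb{N}_0$, where $\binom{i}{2}=\frac{i(i-1)}{2}$. For $n\in\mathbb{N}_0$, $\mu(n):=\min\{m\in\mathbb{N}_0 : (m,n)\in T\}$. *)

theory Defs
  imports Complex_Main
begin

definition z :: "nat \<Rightarrow> nat \<times> nat" where
  "z i = (i, i choose 2)"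

(* The linear combinations \<Sum>i\<in>I. c i * z i are written out componentwise,
   since there is no scalar multiplication on nat \<times> nat. *)
definition T :: "(nat \<times> nat) set" where
  "T = {(\<Sum>i\<in>I. c i * fst (z i), \<Sum>i\<in>I. c i * snd (z i)) |
          (c :: nat \<Rightarrow> nat) (I :: nat set). finite I}"

(* LEAST is a genuine minimum here: (2 * n, n) = n * z 2 lies in T for every n. *)
definition \<mu> :: "nat \<Rightarrow> nat" where
  "\<mu> n = (LEAST m. (m, n) \<in> T)"

end

theory Submission
  imports Defs
begin

text \<open>
  Adding or removing one generator \<open>z i\<close> from a nonnegative combination changes the first
  coordinate by \<open>i\<close> and the second by \<open>i choose 2\<close>. Adding gives the upper bound for
  \<open>\<mu> n\<close>; for \<open>n \<ge> 1\<close> an optimal combination uses some \<open>z i\<close> with \<open>i choose 2 > 0\<close>,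
  and removing it gives equality.
\<close>

lemma T_add_generator:
  assumes "(m, n) \<in> T"
  shows "(m + i, n + (i choose 2)) \<in> T"
proof -
  obtain c and I :: "nat set" where I: "finite I"
    and m: "m = (\<Sum>k\<in>I. c k * fst (z k))" and n: "n = (\<Sum>k\<in>I. c k * snd (z k))"
    using assms unfolding T_def by blast
  \<comment> \<open>The values of \<open>c\<close> outside \<open>I\<close> are arbitrary, so they
    are reset to 0 before one copy of \<open>z i\<close> is added; this covers \<open>i\<close>
    inside and outside \<open>I\<close> alike.\<close>
  define d where "d k = (if k \<in> I then c k else 0) + (if k = i then 1 else 0)" for k
  have d: "(\<Sum>k\<in>insert i I. d k * f k) = (\<Sum>k\<in>I. c k * f k) + f i" for f :: "nat \<Rightarrow> nat"
  proof -
    have "(\<Sum>k\<in>insert i I. d k * f k)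
        = (\<Sum>k\<in>insert i I. if k \<in> I then c k * f k else 0)
          + (\<Sum>k\<in>insert i I. if k = i then f k else 0)"
      unfolding sum.distrib[symmetric] by (rule sum.cong) (auto simp: d_def algebra_simps)
    also have "(\<Sum>k\<in>insert i I. if k \<in> I then c k * f k else 0) = (\<Sum>k\<in>I. c k * f k)"
      using I by (intro sum.mono_neutral_cong_right) auto
    also have "(\<Sum>k\<in>insert i I. if k = i then f k else 0) = f i"
      using I by (subst sum.delta) auto
    finally show ?thesis .
  qed
  have "m + i = (\<Sum>k\<in>insert i I. d k * fst (z k))"
    and "n + (i choose 2) = (\<Sum>k\<in>insert i I. d k * snd (z k))"
    unfolding d m n by (simp_all add: z_def)
  with I show ?thesis unfolding T_def by blast
qed

text \<open>A positive second coordinate forces some term with \<open>c i > 0\<close> and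
  \<open>i choose 2 > 0\<close>; one copy of that \<open>z i\<close> is split off. Positivity of the
  binomial also rules out \<open>i = 0\<close>.\<close>

lemma T_remove_generator:
  assumes "(m, n) \<in> T" and "n \<ge> 1"
  obtains i m' n' where "i \<ge> 1" "(m', n') \<in> T" "m = m' + i" "n = n' + (i choose 2)"
proof -
  obtain c and I :: "nat set" where I: "finite I"
    and m: "m = (\<Sum>k\<in>I. c k * fst (z k))" and n: "n = (\<Sum>k\<in>I. c k * snd (z k))"
    using assms(1) unfolding T_def by blast
  have "\<exists>i\<in>I. c i * snd (z i) \<noteq> 0"
  proof (rule ccontr)
    assume "\<not> (\<exists>i\<in>I. c i * snd (z i) \<noteq> 0)"
    then have "n = 0"
      unfolding n by (intro sum.neutral) blast
    with \<open>n \<ge> 1\<close> show False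
      by simp
  qed
  then obtain i where i: "i \<in> I" "c i > 0" "i choose 2 > 0"
    by (auto simp: z_def)
  then have "i \<ge> 1"
    by (cases i) auto
  define d where "d = c(i := c i - 1)"
  have d: "(\<Sum>k\<in>I. c k * f k) = (\<Sum>k\<in>I. d k * f k) + f i" for f :: "nat \<Rightarrow> nat"
  proof -
    have "(\<Sum>k\<in>I - {i}. c k * f k) = (\<Sum>k\<in>I - {i}. d k * f k)"
      by (rule sum.cong) (auto simp: d_def)
    \<comment> \<open>Subtraction on naturals truncates; \<open>c i > 0\<close> makes
      \<open>c i - 1\<close> lose exactly one copy.\<close>
    moreover have "c i * f i = d i * f i + f i"
      using i(2) by (cases "c i") (auto simp: d_def)
    ultimately show ?thesis
      by (simp add: sum.remove[OF I i(1)])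
  qed
  have "(\<Sum>k\<in>I. d k * fst (z k), \<Sum>k\<in>I. d k * snd (z k)) \<in> T"
    using I unfolding T_def by blast
  moreover have "m = (\<Sum>k\<in>I. d k * fst (z k)) + i"
    and "n = (\<Sum>k\<in>I. d k * snd (z k)) + (i choose 2)"
    unfolding m n d by (simp_all add: z_def)
  ultimately show thesis
    using that \<open>i \<ge> 1\<close> by blast
qed

lemma \<mu>_in_T: "(\<mu> n, n) \<in> T"
proof -
  have "(2 * n, n) \<in> T"
    unfolding T_def by (auto simp: z_def intro!: exI[of _ "\<lambda>_. n"] exI[of _ "{2}"])
  then show ?thesis
    unfolding \<mu>_def by (rule LeastI)
qed

lemma \<mu>_le: "(m, n) \<in> T \<Longrightarrow> \<mu> n \<le> m"
  unfolding \<mu>_def by (rule Least_le)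

text \<open>Bounds the admissible indices by \<open>Suc n\<close>, so that \<open>Min\<close> is
  taken over a finite set. Equality holds at \<open>i = 1\<close> and \<open>i = 2\<close>.\<close>

lemma le_Suc_choose_two: "i \<le> Suc (i choose 2)"
  by (induction i) (auto simp: numeral_2_eq_2)

theorem theorem5p5:
  fixes n :: nat
  assumes "n \<ge> 1"
  shows "\<mu> n = Min {\<mu> (n - (i choose 2)) + i | i :: nat. i \<ge> 1 \<and> (i choose 2) \<le> n}"
proof (rule sym, rule Min_eqI)
  have "i \<le> Suc n" if "i choose 2 \<le> n" for i
    using le_Suc_choose_two[of i] that by linarith
  then have "{i. i \<ge> 1 \<and> (i choose 2) \<le> n} \<subseteq> {..Suc n}"
    by blast
  then have "finite {i. i \<ge> 1 \<and> (i choose 2) \<le> n}"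
    by (rule finite_subset) simp
  then show "finite {\<mu> (n - (i choose 2)) + i | i. i \<ge> 1 \<and> (i choose 2) \<le> n}"
    by (rule finite_image_set)
  have upper: "\<mu> n \<le> \<mu> (n - (i choose 2)) + i" if "i choose 2 \<le> n" for i
    using \<mu>_le[OF T_add_generator[OF \<mu>_in_T[of "n - (i choose 2)"], of i]] that by simp
  then show "\<mu> n \<le> y"
    if "y \<in> {\<mu> (n - (i choose 2)) + i | i. i \<ge> 1 \<and> (i choose 2) \<le> n}" for y
    using that by blast
  \<comment> \<open>Split a generator off an optimal combination. The rest need not be known
    optimal: \<open>\<mu> n' \<le> m'\<close> gives one inequality, and \<open>upper\<close> gives
    the other.\<close>
  obtain i m' n' where i: "i \<ge> 1" "(m', n') \<in> T" "\<mu> n = m' + i" "n = n' + (i choose 2)"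
    using T_remove_generator[OF \<mu>_in_T assms] .
  then have "i choose 2 \<le> n" and "\<mu> (n - (i choose 2)) + i \<le> \<mu> n"
    using \<mu>_le[OF i(2)] by auto
  with upper[of i] have "\<mu> n = \<mu> (n - (i choose 2)) + i"
    by (intro le_antisym)
  with i(1) \<open>i choose 2 \<le> n\<close>
  show "\<mu> n \<in> {\<mu> (n - (i choose 2)) + i | i. i \<ge> 1 \<and> (i choose 2) \<le> n}"
    by blast
qed

end
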